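(* For every $C>0$ there is $C'>0$ such that every graph with nonnegative edge weights whose core density is at most $C$ is $r$ cut pseudorandom with constant $C'$ for every positive integer $r$.
   Context: An $n$-node graph has vertex set $[n]$ and symmetric nonnegative adjacency matrix $A$; $d_i=\sum_jA_{ij}$, and $\overline{d}$ is the average of the $d_i$. The core density is $\sum_{i,j}\frac{A_{ij}^2}{(d_i+\overline{d})(d_j+\overline{d})}$. A cut vector is a nonzero vector in $\{0,1\}^n$; $\|X\|_\square=\max_{s,t\text{ cut vectors}}|s^TXt|$, so $\|A\|_\square=\mathbf{1}^TA\mathbf{1}$. Diagonal inner product: for diagonal $M$ with positive diagonal entries $m_i$, $\langle x,y\rangle_M=x^TMy$, $\|x\|_M=\langle x,x\rangle_M^{1/2}$, and matrices carry $\langle X,Y\rangle_{F,M}=\sum_{i,j}X_{ij}Y_{ij}/(m_im_j)$ with norm $\|\cdot\|_{F,M}$; $\mathrm{Proj}_Q(X)$ is the orthogonal projection w.r.t. this inner product onto $\mathrm{span}\{vw^T:(v,w)\in Q\}$. Cut PVD: $P=\{(s/\|s\|_M,t/\|t\|_M):s,t\text{ cut vectors}\}$; $P^{(0)}=\emptyset$, $p_{j+1}=(v,w)\in P$ maximizes $|v^T(A-\mathrm{Proj}_{P^{(j)}}(A))w|$ (ties arbitrary), $P^{(j+1)}=P^{(j)}\cup\{p_{j+1}\}$; cut projection values $\sigma_j=\|\mathrm{Proj}_{P^{(j)}}(A)-\mathrm{Proj}_{P^{(j-1)}}(A)\|_{F,M}$, $\varsigma^{(r)}=(\sigma_1,\dots,\sigma_r)$.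 The graph is $r$ cut pseudorandom with constant $C'$ if for some such $M$ (and greedy ordering) $\|\varsigma^{(r)}\|_2\le C'\|A\|_\square/\langle\mathbf{1},\mathbf{1}\rangle_M$. *)

theory Defs
  imports "Jordan_Normal_Form.VS_Connect" "HOL-Analysis.L2_Norm"
begin

text \<open>Matrices and vectors are those of \<open>Jordan_Normal_Form.Matrix\<close>, so that the number of
  nodes is an ordinary natural number; the vertex set is indexed from \<open>0\<close>, i.e. \<open>{..<n}\<close>.\<close>

definition weighted_graph :: "nat \<Rightarrow> real mat \<Rightarrow> bool" where
  "weighted_graph n A \<longleftrightarrow> 0 < n \<and> A \<in> carrier_mat n n \<and> transpose_mat A = A \<and>
     (\<forall>i<n. \<forall>j<n. 0 \<le> A $$ (i, j))"

definition weighted_degree :: "real mat \<Rightarrow> nat \<Rightarrow> real" where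
  "weighted_degree A i = (\<Sum>j<dim_col A. A $$ (i, j))"

definition average_degree :: "real mat \<Rightarrow> real" where
  "average_degree A = (\<Sum>i<dim_row A. weighted_degree A i) / real (dim_row A)"

text \<open>For a graph, a denominator below vanishes only if \<open>A = 0\<close>; the core density is then \<open>0\<close>.\<close>

definition core_density :: "real mat \<Rightarrow> real" where
  "core_density A = (\<Sum>i<dim_row A. \<Sum>j<dim_col A.
     (A $$ (i, j))\<^sup>2 /
       ((weighted_degree A i + average_degree A) * (weighted_degree A j + average_degree A)))"

definition cut_vectors :: "nat \<Rightarrow> real vec set" where
  "cut_vectors n = {s \<in> carrier_vec n. s \<noteq> 0\<^sub>v n \<and> (\<forall>i<n. s $ i \<in> {0, 1})}"

definition cut_norm :: "real mat \<Rightarrow> real" where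
  "cut_norm X = Max {\<bar>s \<bullet> (X *\<^sub>v t)\<bar> | s t.
     s \<in> cut_vectors (dim_row X) \<and> t \<in> cut_vectors (dim_col X)}"

definition positive_diagonal :: "nat \<Rightarrow> real mat \<Rightarrow> bool" where
  "positive_diagonal n M \<longleftrightarrow> M \<in> carrier_mat n n \<and> diagonal_mat M \<and> (\<forall>i<n. 0 < M $$ (i, i))"

definition inner_M :: "real mat \<Rightarrow> real vec \<Rightarrow> real vec \<Rightarrow> real" where
  "inner_M M x y = x \<bullet> (M *\<^sub>v y)"

definition norm_M :: "real mat \<Rightarrow> real vec \<Rightarrow> real" where
  "norm_M M x = sqrt (inner_M M x x)"

definition inner_FM :: "real mat \<Rightarrow> real mat \<Rightarrow> real mat \<Rightarrow> real" where
  "inner_FM M X Y = (\<Sum>i<dim_row M. \<Sum>j<dim_row M.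
     X $$ (i, j) * Y $$ (i, j) / (M $$ (i, i) * M $$ (j, j)))"

definition norm_FM :: "real mat \<Rightarrow> real mat \<Rightarrow> real" where
  "norm_FM M X = sqrt (inner_FM M X X)"

definition outer_prod :: "real vec \<Rightarrow> real vec \<Rightarrow> real mat" where
  "outer_prod v w = mat (dim_vec v) (dim_vec w) (\<lambda>(i, j). v $ i * w $ j)"

definition outer_span :: "nat \<Rightarrow> (real vec \<times> real vec) set \<Rightarrow> real mat set" where
  "outer_span n Q = LinearCombinations.module.span class_ring (module_mat TYPE(real) n n)
     {outer_prod v w | v w. (v, w) \<in> Q}"

text \<open>The orthogonal projection exists and is unique whenever \<open>M\<close> is a positive diagonal matrix,
  \<open>X\<close> has the same dimensions as \<open>M\<close>, and all components of \<open>Q\<close> are vectors of that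
  dimension.\<close>

definition Proj :: "real mat \<Rightarrow> (real vec \<times> real vec) set \<Rightarrow> real mat \<Rightarrow> real mat" where
  "Proj M Q X = (THE Y. Y \<in> outer_span (dim_row M) Q \<and>
     (\<forall>Z \<in> outer_span (dim_row M) Q. inner_FM M (X - Y) Z = 0))"

definition cut_pairs :: "real mat \<Rightarrow> (real vec \<times> real vec) set" where
  "cut_pairs M = {((1 / norm_M M s) \<cdot>\<^sub>v s, (1 / norm_M M t) \<cdot>\<^sub>v t) | s t.
     s \<in> cut_vectors (dim_row M) \<and> t \<in> cut_vectors (dim_row M)}"

text \<open>A run of the greedy procedure is a sequence \<open>p\<close> whose \<open>j\<close>-th choice is \<open>p j\<close> for
  \<open>j \<ge> 1\<close>; the value \<open>p 0\<close> is irrelevant. A maximizer may have been chosen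
  before; the projection then no longer changes.\<close>

definition chosen :: "(nat \<Rightarrow> real vec \<times> real vec) \<Rightarrow> nat \<Rightarrow> (real vec \<times> real vec) set" where
  "chosen p j = p ` {1..j}"

definition residual_value :: "real mat \<Rightarrow> (real vec \<times> real vec) set \<Rightarrow> real mat \<Rightarrow>
    real vec \<times> real vec \<Rightarrow> real" where
  "residual_value M Q A = (\<lambda>(v, w). \<bar>v \<bullet> ((A - Proj M Q A) *\<^sub>v w)\<bar>)"

definition greedy_cut_pvd :: "real mat \<Rightarrow> real mat \<Rightarrow> (nat \<Rightarrow> real vec \<times> real vec) \<Rightarrow> bool" where
  "greedy_cut_pvd M A p \<longleftrightarrow>
     (\<forall>j. is_arg_max (residual_value M (chosen p j) A) (\<lambda>q. q \<in> cut_pairs M) (p (Suc j)))"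

definition cut_projection_value ::
  "real mat \<Rightarrow> real mat \<Rightarrow> (nat \<Rightarrow> real vec \<times> real vec) \<Rightarrow> nat \<Rightarrow> real" where
  "cut_projection_value M A p j =
     norm_FM M (Proj M (chosen p j) A - Proj M (chosen p (j - 1)) A)"

definition cut_pseudorandom :: "nat \<Rightarrow> real \<Rightarrow> real mat \<Rightarrow> bool" where
  "cut_pseudorandom r C' A \<longleftrightarrow>
     (\<exists>M p. positive_diagonal (dim_row A) M \<and> greedy_cut_pvd M A p \<and>
        L2_set (cut_projection_value M A p) {1..r} \<le>
          C' * cut_norm A / inner_M M (vec (dim_row A) (\<lambda>_. 1)) (vec (dim_row A) (\<lambda>_. 1)))"

end

theory Submission
  imports Defs
begin

text \<open>Take \<open>M = diag (d\<^sub>i + d)\<close> with \<open>d\<close> the average degree. Then \<open>\<parallel>A\<parallel>\<^sup>2\<close> in the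
  \<open>F,M\<close>-norm is exactly the core density, and \<open>\<langle>1,1\<rangle>\<^sub>M\<close> is twice the total weight
  \<open>1\<^sup>T A 1\<close>. The projections of \<open>A\<close> are onto increasing subspaces, so by Pythagoras the
  squares of the cut projection values sum to at most \<open>\<parallel>A\<parallel>\<^sup>2\<close>, whatever choices the
  greedy procedure makes. Hence \<open>C' = 2 sqrt C\<close> works.\<close>

section \<open>The weighted Frobenius inner product\<close>

locale diagonal_weight =
  fixes n :: nat and M :: "real mat"
  assumes positive_diagonal: "positive_diagonal n M"
begin

lemma dim_M [simp]: "dim_row M = n" "dim_col M = n"
  and diag_pos: "i < n \<Longrightarrow> 0 < M $$ (i, i)"
  and off_diag: "i < n \<Longrightarrow> j < n \<Longrightarrow> i \<noteq> j \<Longrightarrow> M $$ (i, j) = 0"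
  using positive_diagonal by (auto simp: positive_diagonal_def diagonal_mat_def)

lemma inner_FM_sym: "inner_FM M X Y = inner_FM M Y X"
  by (simp add: inner_FM_def mult.commute)

lemma inner_FM_add_left:
  assumes "X \<in> carrier_mat n n" "Y \<in> carrier_mat n n"
  shows "inner_FM M (X + Y) Z = inner_FM M X Z + inner_FM M Y Z"
  using assms by (simp add: inner_FM_def sum.distrib distrib_right add_divide_distrib)

lemma inner_FM_smult_left:
  assumes "X \<in> carrier_mat n n"
  shows "inner_FM M (c \<cdot>\<^sub>m X) Z = c * inner_FM M X Z"
  using assms by (simp add: inner_FM_def sum_distrib_left mult.assoc)

lemma inner_FM_diff_left:
  assumes "X \<in> carrier_mat n n" "Y \<in> carrier_mat n n"
  shows "inner_FM M (X - Y) Z = inner_FM M X Z - inner_FM M Y Z"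
  using assms by (simp add: inner_FM_def sum_subtractf left_diff_distrib diff_divide_distrib)

lemma inner_FM_add_right:
  assumes "X \<in> carrier_mat n n" "Y \<in> carrier_mat n n"
  shows "inner_FM M Z (X + Y) = inner_FM M Z X + inner_FM M Z Y"
  using inner_FM_add_left[OF assms] by (simp add: inner_FM_sym)

lemma inner_FM_smult_right:
  assumes "X \<in> carrier_mat n n"
  shows "inner_FM M Z (c \<cdot>\<^sub>m X) = c * inner_FM M Z X"
  using inner_FM_smult_left[OF assms] by (simp add: inner_FM_sym)

lemma inner_FM_square_add:
  assumes "X \<in> carrier_mat n n" "Y \<in> carrier_mat n n" "inner_FM M X Y = 0"
  shows "inner_FM M (X + Y) (X + Y) = inner_FM M X X + inner_FM M Y Y"
  using assms inner_FM_sym[of Y X] by (simp add: inner_FM_add_left inner_FM_add_right)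

lemma inner_FM_zero_right: "inner_FM M X (0\<^sub>m n n) = 0"
  by (simp add: inner_FM_def)

lemma inner_FM_term_nonneg:
  "i < n \<Longrightarrow> j < n \<Longrightarrow> 0 \<le> X $$ (i, j) * X $$ (i, j) / (M $$ (i, i) * M $$ (j, j))"
  using diag_pos by (simp add: less_imp_le)

lemma inner_FM_nonneg: "0 \<le> inner_FM M X X"
  unfolding inner_FM_def by (intro sum_nonneg) (simp add: inner_FM_term_nonneg)

text \<open>The outer and then the inner sum of nonnegative terms vanishes termwise, and the weights
  are positive. Definiteness is what makes projections unique and settles the degenerate case of
  Gram-Schmidt.\<close>

lemma inner_FM_definite:
  assumes "X \<in> carrier_mat n n" "inner_FM M X X = 0"
  shows "X = 0\<^sub>m n n"
proof (rule eq_matI)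
  fix i j assume "i < dim_row (0\<^sub>m n n :: real mat)" "j < dim_col (0\<^sub>m n n :: real mat)"
  hence ij: "i < n" "j < n" by auto
  have "\<forall>i\<in>{..<n}. (\<Sum>j<n. X $$ (i, j) * X $$ (i, j) / (M $$ (i, i) * M $$ (j, j))) = 0"
    using assms(2) unfolding inner_FM_def dim_M
    by (subst (asm) sum_nonneg_eq_0_iff) (auto intro!: sum_nonneg inner_FM_term_nonneg)
  hence "(\<Sum>j<n. X $$ (i, j) * X $$ (i, j) / (M $$ (i, i) * M $$ (j, j))) = 0"
    using ij by simp
  hence "\<forall>j\<in>{..<n}. X $$ (i, j) * X $$ (i, j) / (M $$ (i, i) * M $$ (j, j)) = 0"
    by (subst (asm) sum_nonneg_eq_0_iff) (use ij in \<open>auto intro!: inner_FM_term_nonneg\<close>)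
  thus "X $$ (i, j) = 0\<^sub>m n n $$ (i, j)"
    using ij diag_pos[of i] diag_pos[of j] by auto
qed (use assms in auto)

lemma norm_FM_square: "(norm_FM M X)\<^sup>2 = inner_FM M X X"
  by (simp add: norm_FM_def inner_FM_nonneg)

lemma inner_M_eq:
  assumes "x \<in> carrier_vec n" "y \<in> carrier_vec n"
  shows "inner_M M x y = (\<Sum>i<n. M $$ (i, i) * x $ i * y $ i)"
proof -
  have "(M *\<^sub>v y) $ i = M $$ (i, i) * y $ i" if "i < n" for i
  proof -
    have "(M *\<^sub>v y) $ i = (\<Sum>j<n. M $$ (i, j) * y $ j)"
      using that assms by (simp add: scalar_prod_def atLeast0LessThan)
    also have "\<dots> = (\<Sum>j<n. if j = i then M $$ (i, i) * y $ i else 0)"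
      using that by (intro sum.cong) (auto simp: off_diag)
    finally show ?thesis using that by simp
  qed
  thus ?thesis
    using assms by (simp add: inner_M_def scalar_prod_def atLeast0LessThan mult.left_commute mult.assoc)
qed

section \<open>Orthogonal projections\<close>

sublocale mats: vectorspace class_ring "module_mat TYPE(real) n n"
  by (rule matrix_vs)

lemma span_add:
  assumes "S \<subseteq> carrier_mat n n" "X \<in> mats.span S" "Y \<in> mats.span S"
  shows "X + Y \<in> mats.span S"
  using mats.span_add1[of S X Y] assms by (simp add: module_mat_simps)

lemma span_smult:
  assumes "S \<subseteq> carrier_mat n n" "X \<in> mats.span S"
  shows "c \<cdot>\<^sub>m X \<in> mats.span S"
  using mats.span_is_submodule[of S] assms
  by (auto simp: module_mat_simps submodule_def class_ring_simps)

lemma span_carrier: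
  assumes "S \<subseteq> carrier_mat n n"
  shows "mats.span S \<subseteq> carrier_mat n n"
  using mats.span_is_subset2[of S] assms by (simp add: module_mat_simps)

lemma span_diff:
  assumes "S \<subseteq> carrier_mat n n" "X \<in> mats.span S" "Y \<in> mats.span S"
  shows "X - Y \<in> mats.span S"
proof -
  have "X - Y = X + (-1) \<cdot>\<^sub>m Y"
    using assms span_carrier[OF assms(1)] by (intro eq_matI) auto
  thus ?thesis using assms by (simp add: span_add span_smult)
qed

text \<open>The matrices orthogonal to \<open>X\<close> form a submodule; as it contains
  \<open>S\<close>, it contains the span of \<open>S\<close>.\<close>

lemma orthogonal_span:
  assumes "S \<subseteq> carrier_mat n n" "\<And>Z. Z \<in> S \<Longrightarrow> inner_FM M X Z = 0" "Z \<in> mats.span S"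
  shows "inner_FM M X Z = 0"
proof -
  let ?N = "{Z \<in> carrier_mat n n. inner_FM M X Z = 0}"
  have "submodule class_ring ?N (module_mat TYPE(real) n n)"
    using mats.module_axioms
    by (auto simp: submodule_def module_mat_simps class_ring_simps inner_FM_add_right
        inner_FM_smult_right inner_FM_zero_right)
  hence "mats.span S \<subseteq> ?N"
    by (intro mats.span_is_subset) (use assms in auto)
  thus ?thesis using assms(3) by auto
qed

text \<open>Gram-Schmidt by induction on \<open>S\<close>. \<open>X\<close> is kept arbitrary
  because the induction hypothesis is applied twice: to \<open>X\<close> itself and to the new
  generator \<open>u\<close>.\<close>

lemma projection_exists:
  assumes "finite S" "S \<subseteq> carrier_mat n n" "X \<in> carrier_mat n n"
  shows "\<exists>Y \<in> mats.span S. \<forall>Z \<in> mats.span S. inner_FM M (X - Y) Z = 0"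
  using assms
proof (induction S arbitrary: X rule: finite_induct)
  case empty
  then show ?case
    by (auto simp: mats.span_empty module_mat_simps inner_FM_zero_right)
next
  case (insert u S)
  note S = insert.prems(1)
  have carr: "S \<subseteq> carrier_mat n n" "u \<in> carrier_mat n n"
    and X: "X \<in> carrier_mat n n"
    using insert.prems by auto
  obtain Y where Y: "Y \<in> mats.span S" "\<And>Z. Z \<in> mats.span S \<Longrightarrow> inner_FM M (X - Y) Z = 0"
    using insert.IH[OF carr(1) X] by blast
  obtain W where W: "W \<in> mats.span S" "\<And>Z. Z \<in> mats.span S \<Longrightarrow> inner_FM M (u - W) Z = 0"
    using insert.IH[OF carr] by blast
  \<comment> \<open>\<open>U\<close> is the part of \<open>u\<close> orthogonal to the span of
    \<open>S\<close>, and \<open>c\<close> is the coefficient of \<open>X\<close> along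
    \<open>U\<close>; the new projection will be \<open>Y + c U\<close>.\<close>
  define U where "U = u - W"
  define c where "c = inner_FM M X U / inner_FM M U U"
  have Yc: "Y \<in> carrier_mat n n" and Wc: "W \<in> carrier_mat n n"
    using Y W span_carrier[OF carr(1)] by auto
  have Uc: "U \<in> carrier_mat n n"
    using carr Wc by (simp add: U_def minus_carrier_mat)
  have mono: "mats.span S \<subseteq> mats.span (insert u S)"
    by (intro mats.span_is_monotone) auto
  have gen: "S \<subseteq> mats.span S" "u \<in> mats.span (insert u S)"
    using mats.in_own_span[of S] mats.in_own_span[of "insert u S"] carr
    by (auto simp: module_mat_simps)
  have U_span: "U \<in> mats.span (insert u S)"
    unfolding U_def using gen W mono S by (intro span_diff) auto
  \<comment> \<open>If \<open>u\<close> already lies in the span of \<open>S\<close>, then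
    \<open>U\<close> is zero and \<open>c\<close> is \<open>0 / 0 = 0\<close>; the identity survives
    because both sides vanish.\<close>
  have cU: "c * inner_FM M U U = inner_FM M X U"
  proof (cases "inner_FM M U U = 0")
    case True
    hence "U = 0\<^sub>m n n" using inner_FM_definite Uc by blast
    thus ?thesis by (simp add: inner_FM_zero_right)
  qed (simp add: c_def)
  let ?Y = "Y + c \<cdot>\<^sub>m U"
  have Y'c: "?Y \<in> carrier_mat n n" using Yc Uc by simp
  have expand: "inner_FM M (X - ?Y) Z = inner_FM M (X - Y) Z - c * inner_FM M U Z" for Z
    using X Yc Uc by (simp add: inner_FM_diff_left inner_FM_add_left inner_FM_smult_left)
  have S_orth: "inner_FM M (X - ?Y) Z = 0" if "Z \<in> mats.span S" for Z
    using Y(2)[OF that] W(2)[OF that] by (simp add: expand U_def[symmetric])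
  \<comment> \<open>\<open>Y\<close> lies in the span of \<open>S\<close>, to which \<open>U\<close>
    is orthogonal. So the residual \<open>X - Y\<close> has the same product with \<open>U\<close>
    as \<open>X\<close>, and subtracting \<open>c U\<close> cancels it.\<close>
  have "inner_FM M Y U = 0"
    using W(2)[OF Y(1)] by (simp add: U_def inner_FM_sym)
  hence "inner_FM M (X - ?Y) U = 0"
    using cU X Yc by (simp add: expand inner_FM_diff_left)
  \<comment> \<open>Since \<open>W\<close> is in the span of \<open>S\<close>, orthogonality to
    \<open>U\<close> and to that span gives orthogonality to \<open>u\<close>.\<close>
  moreover have "u = U + W"
    using carr Wc by (auto simp: U_def)
  ultimately have "inner_FM M (X - ?Y) u = 0"
    using S_orth[OF W(1)] inner_FM_add_right[OF Uc Wc] by (metis add_0)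
  hence "inner_FM M (X - ?Y) Z = 0" if "Z \<in> mats.span (insert u S)" for Z
    using S_orth gen(1) by (intro orthogonal_span[OF S _ that]) blast
  moreover have "?Y \<in> mats.span (insert u S)"
    using Y mono U_span S by (intro span_add span_smult) auto
  ultimately show ?case by blast
qed

lemma outer_span_eq: "outer_span n Q = mats.span {outer_prod v w | v w. (v, w) \<in> Q}"
  by (simp add: outer_span_def)

text \<open>This discharges the definite description in \<open>Proj\<close>: existence is
  Gram-Schmidt on the finitely many outer products, and uniqueness follows from
  definiteness.\<close>

lemma Proj_props:
  assumes "finite Q" "Q \<subseteq> carrier_vec n \<times> carrier_vec n" "X \<in> carrier_mat n n"
  shows Proj_in_span: "Proj M Q X \<in> outer_span n Q"
    and Proj_orthogonal: "Z \<in> outer_span n Q \<Longrightarrow> inner_FM M (X - Proj M Q X) Z = 0"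
proof -
  let ?S = "{outer_prod v w | v w. (v, w) \<in> Q}"
  have "?S = (\<lambda>(v, w). outer_prod v w) ` Q" by auto
  hence fin: "finite ?S" using assms(1) by simp
  have S: "?S \<subseteq> carrier_mat n n"
    using assms(2) by (auto simp: outer_prod_def)
  obtain Y where Y: "Y \<in> mats.span ?S" "\<forall>Z \<in> mats.span ?S. inner_FM M (X - Y) Z = 0"
    using projection_exists[OF fin S assms(3)] by blast
  have "Proj M Q X \<in> outer_span (dim_row M) Q \<and>
      (\<forall>Z \<in> outer_span (dim_row M) Q. inner_FM M (X - Proj M Q X) Z = 0)"
    unfolding Proj_def
  proof (rule theI)
    show "Y \<in> outer_span (dim_row M) Q \<and>
        (\<forall>Z \<in> outer_span (dim_row M) Q. inner_FM M (X - Y) Z = 0)"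
      using Y by (simp add: outer_span_eq)
  next
    fix Y' assume "Y' \<in> outer_span (dim_row M) Q \<and>
        (\<forall>Z \<in> outer_span (dim_row M) Q. inner_FM M (X - Y') Z = 0)"
    hence Y': "Y' \<in> mats.span ?S" "\<forall>Z \<in> mats.span ?S. inner_FM M (X - Y') Z = 0"
      by (auto simp: outer_span_eq)
    have c: "Y \<in> carrier_mat n n" "Y' \<in> carrier_mat n n"
      using Y Y' span_carrier[OF S] by auto
    \<comment> \<open>The difference of two candidates lies in the span, so it may serve as test
      matrix in both orthogonality conditions; subtracting them shows that it is orthogonal to
      itself.\<close>
    have "Y' - Y \<in> mats.span ?S" using S Y Y' by (intro span_diff) auto
    hence "inner_FM M (X - Y) (Y' - Y) = 0" "inner_FM M (X - Y') (Y' - Y) = 0"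
      using Y(2) Y'(2) by auto
    hence "inner_FM M (Y' - Y) (Y' - Y) = 0"
      using assms(3) c by (simp add: inner_FM_diff_left)
    hence "Y' - Y = 0\<^sub>m n n"
      using c by (intro inner_FM_definite) (auto simp: minus_carrier_mat)
    thus "Y' = Y"
    proof (intro eq_matI)
      fix i j assume "i < dim_row Y" "j < dim_col Y"
      thus "Y' $$ (i, j) = Y $$ (i, j)"
        using arg_cong[OF \<open>Y' - Y = 0\<^sub>m n n\<close>, of "\<lambda>X. X $$ (i, j)"] c by simp
    qed (use c in auto)
  qed
  thus "Proj M Q X \<in> outer_span n Q"
    and "Z \<in> outer_span n Q \<Longrightarrow> inner_FM M (X - Proj M Q X) Z = 0"
    by simp_all
qed

lemma outer_span_mono: "Q \<subseteq> R \<Longrightarrow> outer_span n Q \<subseteq> outer_span n R"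
  unfolding outer_span_eq by (intro mats.span_is_monotone) auto

lemma outer_span_diff:
  assumes "Q \<subseteq> carrier_vec n \<times> carrier_vec n" "X \<in> outer_span n Q" "Y \<in> outer_span n Q"
  shows "X - Y \<in> outer_span n Q"
proof -
  have "{outer_prod v w | v w. (v, w) \<in> Q} \<subseteq> carrier_mat n n"
    using assms(1) by (auto simp: outer_prod_def)
  thus ?thesis using assms(2,3) unfolding outer_span_eq by (intro span_diff)
qed

lemma Proj_carrier:
  assumes "finite Q" "Q \<subseteq> carrier_vec n \<times> carrier_vec n" "X \<in> carrier_mat n n"
  shows "Proj M Q X \<in> carrier_mat n n"
proof -
  have "{outer_prod v w | v w. (v, w) \<in> Q} \<subseteq> carrier_mat n n"
    using assms(2) by (auto simp: outer_prod_def)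
  from span_carrier[OF this] show ?thesis
    using Proj_in_span[OF assms] by (auto simp: outer_span_eq)
qed

text \<open>As \<open>Q\<close> is contained in \<open>R\<close>, both projections lie in the span
  belonging to \<open>R\<close>, and so does their difference. The residual for \<open>R\<close> is
  orthogonal to that span.\<close>

lemma residual_pythagoras:
  assumes "finite R" "R \<subseteq> carrier_vec n \<times> carrier_vec n" "Q \<subseteq> R" "X \<in> carrier_mat n n"
  shows "(norm_FM M (X - Proj M Q X))\<^sup>2 =
    (norm_FM M (Proj M R X - Proj M Q X))\<^sup>2 + (norm_FM M (X - Proj M R X))\<^sup>2"
proof -
  have Q: "finite Q" "Q \<subseteq> carrier_vec n \<times> carrier_vec n"
    using assms finite_subset by auto
  note carr = Proj_carrier[OF Q assms(4)] Proj_carrier[OF assms(1,2,4)]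
  have "Proj M Q X \<in> outer_span n R"
    using Proj_in_span[OF Q assms(4)] outer_span_mono[OF assms(3)] by auto
  hence "inner_FM M (X - Proj M R X) (Proj M R X - Proj M Q X) = 0"
    using assms by (intro Proj_orthogonal outer_span_diff Proj_in_span)
  moreover have "X - Proj M Q X = (Proj M R X - Proj M Q X) + (X - Proj M R X)"
    using assms(4) carr by (intro eq_matI) auto
  ultimately show ?thesis
    unfolding norm_FM_square using assms(4) carr
    by (metis inner_FM_square_add minus_carrier_mat inner_FM_sym)
qed

end

section \<open>Greedy choices\<close>

text \<open>Finiteness gives meaning to the \<open>Max\<close> in \<open>cut_norm\<close> and
  guarantees maximizers for the greedy procedure.\<close>

lemma finite_cut_vectors: "finite (cut_vectors k)"
proof -
  have "cut_vectors k \<subseteq> vec_of_list ` {xs. set xs \<subseteq> {0, 1} \<and> length xs = k}"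
  proof
    fix s assume s: "s \<in> cut_vectors k"
    hence "set (list_of_vec s) \<subseteq> {0, 1}" "length (list_of_vec s) = k"
      by (auto simp: cut_vectors_def set_conv_nth list_of_vec_index)
    moreover have "s = vec_of_list (list_of_vec s)" by (simp add: vec_list)
    ultimately show "s \<in> vec_of_list ` {xs. set xs \<subseteq> {0, 1} \<and> length xs = k}" by blast
  qed
  thus ?thesis by (rule finite_subset) (simp add: finite_lists_length_eq)
qed

lemma ones_cut_vector: "0 < n \<Longrightarrow> vec n (\<lambda>_. 1) \<in> cut_vectors n"
  by (auto simp: cut_vectors_def dest: arg_cong[where f = "\<lambda>v. v $ 0"])

lemma finite_cut_pairs: "finite (cut_pairs M)"
proof -
  have "cut_pairs M = (\<lambda>(s, t). ((1 / norm_M M s) \<cdot>\<^sub>v s, (1 / norm_M M t) \<cdot>\<^sub>v t)) `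
      (cut_vectors (dim_row M) \<times> cut_vectors (dim_row M))"
    by (auto simp: cut_pairs_def)
  thus ?thesis by (simp add: finite_cut_vectors)
qed

lemma cut_pairs_nonempty:
  assumes "0 < dim_row M"
  shows "cut_pairs M \<noteq> {}"
  using ones_cut_vector[OF assms] by (auto simp: cut_pairs_def)

lemma cut_pairs_carrier:
  "cut_pairs M \<subseteq> carrier_vec (dim_row M) \<times> carrier_vec (dim_row M)"
  by (auto simp: cut_pairs_def cut_vectors_def)

lemma chosen_Suc: "chosen p (Suc j) = insert (p (Suc j)) (chosen p j)"
  by (simp add: chosen_def atLeastAtMostSuc_conv)

text \<open>Pseudorandomness asserts that a greedy run exists, so one has to be built. A maximizer
  exists for every set of earlier choices because there are finitely many cut pairs, and at least
  one.\<close>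

lemma greedy_cut_pvd_exists:
  assumes "0 < dim_row M"
  shows "\<exists>p. greedy_cut_pvd M A p"
proof -
  have ex: "\<exists>q. is_arg_max (residual_value M Q A) (\<lambda>q. q \<in> cut_pairs M) q" for Q
    using obtains_MAX[OF finite_cut_pairs cut_pairs_nonempty[OF assms], of "residual_value M Q A"]
    by (metis Max_ge finite_cut_pairs finite_imageI imageI is_arg_max_linorder)
  define next_pair where
    "next_pair Q = (SOME q. is_arg_max (residual_value M Q A) (\<lambda>q. q \<in> cut_pairs M) q)" for Q
  \<comment> \<open>The recursion runs over the set of chosen pairs, since the next choice depends
    on nothing else. The shift makes \<open>p (Suc j)\<close> the choice made after
    \<open>Q j\<close>; \<open>p 0\<close> is a dummy that \<open>chosen\<close> never
    reads.\<close>
  define Q where "Q = rec_nat {} (\<lambda>_ Q. insert (next_pair Q) Q)"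
  define p where "p j = next_pair (Q (j - 1))" for j
  have "chosen p j = Q j" for j
    by (induction j) (simp_all add: chosen_Suc, simp_all add: chosen_def Q_def p_def)
  hence "greedy_cut_pvd M A p"
    unfolding greedy_cut_pvd_def p_def next_pair_def using someI_ex[OF ex] by simp
  thus ?thesis by blast
qed

section \<open>Pythagoras along a greedy run\<close>

context diagonal_weight
begin

lemma chosen_carrier:
  assumes "greedy_cut_pvd M A p"
  shows "chosen p j \<subseteq> carrier_vec n \<times> carrier_vec n"
proof -
  have "p k \<in> cut_pairs M" if "k \<ge> 1" for k
    using assms that by (cases k) (auto simp: greedy_cut_pvd_def is_arg_max_def)
  thus ?thesis using cut_pairs_carrier[of M] by (fastforce simp: chosen_def)
qed

text \<open>The chosen sets are nested, so Pythagoras turns each squared value into a drop of the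
  squared residual norm, and the sum telescopes.\<close>

lemma sum_cut_projection_values:
  assumes "greedy_cut_pvd M A p" "A \<in> carrier_mat n n"
  shows "(\<Sum>j\<in>{1..r}. (cut_projection_value M A p j)\<^sup>2) =
    (norm_FM M (A - Proj M (chosen p 0) A))\<^sup>2 - (norm_FM M (A - Proj M (chosen p r) A))\<^sup>2"
proof (induction r)
  case (Suc r)
  have "(norm_FM M (A - Proj M (chosen p r) A))\<^sup>2 =
      (norm_FM M (Proj M (chosen p (Suc r)) A - Proj M (chosen p r) A))\<^sup>2 +
      (norm_FM M (A - Proj M (chosen p (Suc r)) A))\<^sup>2"
    using chosen_carrier[OF assms(1), of "Suc r"] assms(2)
    by (intro residual_pythagoras) (auto simp: chosen_def)
  thus ?case using Suc by (simp add: cut_projection_value_def)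
qed simp

lemma L2_cut_projection_values_le:
  assumes "greedy_cut_pvd M A p" "A \<in> carrier_mat n n"
  shows "L2_set (cut_projection_value M A p) {1..r} \<le> norm_FM M A"
proof -
  \<comment> \<open>The span of the empty set is zero, so the initial residual is \<open>A\<close>
    itself; the final residual is then dropped as a nonnegative square.\<close>
  have "Proj M {} A \<in> outer_span n {}"
    using assms(2) by (intro Proj_in_span) auto
  hence "Proj M (chosen p 0) A = 0\<^sub>m n n"
    by (simp add: chosen_def outer_span_eq mats.span_empty module_mat_simps)
  moreover have "A - 0\<^sub>m n n = A"
    using assms(2) by (intro eq_matI) auto
  ultimately have "(\<Sum>j\<in>{1..r}. (cut_projection_value M A p j)\<^sup>2) \<le> (norm_FM M A)\<^sup>2"
    using sum_cut_projection_values[OF assms, of r] by simp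
  thus ?thesis
    unfolding L2_set_def norm_FM_square by (simp add: norm_FM_def)
qed

end

section \<open>Core density\<close>

lemma cut_norm_ge:
  assumes "A \<in> carrier_mat n n" "s \<in> cut_vectors n" "t \<in> cut_vectors n"
  shows "\<bar>s \<bullet> (A *\<^sub>v t)\<bar> \<le> cut_norm A"
proof -
  have "{\<bar>s \<bullet> (A *\<^sub>v t)\<bar> | s t. s \<in> cut_vectors n \<and> t \<in> cut_vectors n} =
      (\<lambda>(s, t). \<bar>s \<bullet> (A *\<^sub>v t)\<bar>) ` (cut_vectors n \<times> cut_vectors n)"
    by auto
  hence "finite {\<bar>s \<bullet> (A *\<^sub>v t)\<bar> | s t. s \<in> cut_vectors n \<and> t \<in> cut_vectors n}"
    by (simp add: finite_cut_vectors)
  thus ?thesis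
    unfolding cut_norm_def using assms by (intro Max_ge) auto
qed

text \<open>The pair of all-ones vectors competes in the maximum; \<open>0 < n\<close> makes them
  nonzero.\<close>

lemma total_degree_le_cut_norm:
  assumes "A \<in> carrier_mat n n" "0 < n"
  shows "(\<Sum>i<n. weighted_degree A i) \<le> cut_norm A"
proof -
  let ?one = "vec n (\<lambda>_. 1) :: real vec"
  have "(A *\<^sub>v ?one) $ i = weighted_degree A i" if "i < n" for i
    using that assms by (simp add: weighted_degree_def scalar_prod_def atLeast0LessThan)
  hence "?one \<bullet> (A *\<^sub>v ?one) = (\<Sum>i<n. weighted_degree A i)"
    using assms by (simp add: scalar_prod_def atLeast0LessThan)
  thus ?thesis
    using cut_norm_ge[OF assms(1), of ?one ?one] ones_cut_vector[OF assms(2)] by simp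
qed

lemma weighted_degree_nonneg:
  assumes "weighted_graph n A" "i < n"
  shows "0 \<le> weighted_degree A i"
  using assms by (auto simp: weighted_graph_def weighted_degree_def intro!: sum_nonneg)

lemma cut_pseudorandom_core_density:
  assumes G: "weighted_graph n A"
  shows "cut_pseudorandom r (2 * sqrt (core_density A)) A"
proof -
  have n: "0 < n" and A: "A \<in> carrier_mat n n"
    using G by (auto simp: weighted_graph_def)
  define T where "T = (\<Sum>i<n. weighted_degree A i)"
  have T0: "0 \<le> T"
    unfolding T_def by (intro sum_nonneg) (use G weighted_degree_nonneg in auto)
  have avg: "average_degree A = T / n"
    using A by (simp add: average_degree_def T_def)
  \<comment> \<open>For \<open>T = 0\<close>, i.e. \<open>A = 0\<close>, the weights \<open>d\<^sub>i + d\<close> vanish and are replaced by \<open>1\<close>.\<close>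
  define m where "m i = (if T = 0 then 1 else weighted_degree A i + average_degree A)" for i
  define M where "M = mat n n (\<lambda>(i, j). if i = j then m i else 0)"
  \<comment> \<open>For \<open>T > 0\<close> the average degree is positive, so even an isolated
    vertex gets positive weight.\<close>
  have m_pos: "0 < m i" if "i < n" for i
    using T0 n weighted_degree_nonneg[OF G that] by (auto simp: m_def avg intro!: add_nonneg_pos)
  interpret diagonal_weight n M
    by unfold_locales (auto simp: positive_diagonal_def diagonal_mat_def M_def m_pos)
  \<comment> \<open>Nonnegativity is used twice: zero total forces zero degrees, and a zero degree
    forces a zero row.\<close>
  have A0: "A $$ (i, j) = 0" if "T = 0" "i < n" "j < n" for i j
  proof -
    have "weighted_degree A i = 0"
      using \<open>T = 0\<close> \<open>i < n\<close> weighted_degree_nonneg[OF G] unfolding T_def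
      by (subst (asm) sum_nonneg_eq_0_iff) auto
    thus ?thesis
      using G A \<open>i < n\<close> \<open>j < n\<close> unfolding weighted_degree_def weighted_graph_def
      by (subst (asm) sum_nonneg_eq_0_iff) auto
  qed
  \<comment> \<open>For nonzero \<open>T\<close> the summands coincide by the choice of
    \<open>m\<close>; for \<open>T = 0\<close> all numerators are zero.\<close>
  have norm_A: "norm_FM M A = sqrt (core_density A)"
    unfolding norm_FM_def inner_FM_def core_density_def dim_M using A A0
    by (auto simp: M_def m_def power2_eq_square intro!: sum.cong arg_cong[where f = sqrt])
  let ?one = "vec n (\<lambda>_. 1) :: real vec"
  have one_M: "inner_M M ?one ?one = (\<Sum>i<n. m i)"
    by (subst inner_M_eq) (simp_all add: M_def)
  have one_pos: "0 < (\<Sum>i<n. m i)"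
    using n m_pos by (intro sum_pos) auto
  obtain p where p: "greedy_cut_pvd M A p"
    using greedy_cut_pvd_exists[of M A] n by auto
  have dens: "0 \<le> sqrt (core_density A)"
    unfolding norm_A[symmetric] by (simp add: norm_FM_def inner_FM_nonneg)
  have cut: "T \<le> cut_norm A"
    unfolding T_def using A n by (rule total_degree_le_cut_norm)
  have "sqrt (core_density A) * (\<Sum>i<n. m i) \<le> 2 * sqrt (core_density A) * cut_norm A"
  proof (cases "T = 0")
    case True
    hence "core_density A = 0"
      using A A0 by (simp add: core_density_def)
    thus ?thesis by simp
  next
    case False
    \<comment> \<open>Source of the factor 2: the degrees sum to \<open>T\<close>, and so do
      \<open>n\<close> copies of the average \<open>T / n\<close>.\<close>
    hence "(\<Sum>i<n. m i) = 2 * T"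
      using n by (simp add: m_def sum.distrib avg T_def[symmetric])
    moreover have "sqrt (core_density A) * (2 * T) \<le> 2 * sqrt (core_density A) * cut_norm A"
      using mult_left_mono[OF cut dens] by linarith
    ultimately show ?thesis by metis
  qed
  hence "sqrt (core_density A) \<le> 2 * sqrt (core_density A) * cut_norm A / (\<Sum>i<n. m i)"
    using one_pos by (simp add: pos_le_divide_eq)
  hence "L2_set (cut_projection_value M A p) {1..r} \<le>
      2 * sqrt (core_density A) * cut_norm A / inner_M M ?one ?one"
    using L2_cut_projection_values_le[OF p A, of r] by (simp add: norm_A one_M)
  thus ?thesis
    using p positive_diagonal A unfolding cut_pseudorandom_def by auto
qed

text \<open>The same \<open>M\<close> and \<open>p\<close> work, because the cut norm and the
  squared norm of the all-ones vector are nonnegative. This replaces a constant depending on the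
  graph by a uniform one.\<close>

lemma cut_pseudorandom_mono:
  assumes "cut_pseudorandom r c A" "c \<le> c'" "weighted_graph n A"
  shows "cut_pseudorandom r c' A"
proof -
  have A: "A \<in> carrier_mat n n" "0 < n"
    using assms(3) by (auto simp: weighted_graph_def)
  let ?one = "vec n (\<lambda>_. 1) :: real vec"
  obtain M p where M: "positive_diagonal n M" "greedy_cut_pvd M A p"
    and le: "L2_set (cut_projection_value M A p) {1..r} \<le> c * cut_norm A / inner_M M ?one ?one"
    using assms(1) A by (auto simp: cut_pseudorandom_def)
  interpret diagonal_weight n M by unfold_locales fact
  have "0 \<le> cut_norm A"
    using cut_norm_ge[OF A(1) ones_cut_vector ones_cut_vector] A(2) by (meson abs_ge_zero order_trans)
  moreover have "0 \<le> inner_M M ?one ?one"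
    using diag_pos by (auto simp: inner_M_eq less_imp_le intro!: sum_nonneg)
  ultimately have "c * cut_norm A / inner_M M ?one ?one \<le> c' * cut_norm A / inner_M M ?one ?one"
    using assms(2) by (intro divide_right_mono mult_right_mono)
  thus ?thesis
    using M A le unfolding cut_pseudorandom_def by (intro exI[of _ M] exI[of _ p]) auto
qed

theorem theorem27:
  shows "\<forall>C::real. C > 0 \<longrightarrow> (\<exists>C'::real. C' > 0 \<and>
    (\<forall>n A. weighted_graph n A \<and> core_density A \<le> C \<longrightarrow>
      (\<forall>r::nat. r \<ge> 1 \<longrightarrow> cut_pseudorandom r C' A)))"
proof (intro allI impI)
  fix C :: real assume "C > 0"
  \<comment> \<open>Monotonicity of the square root bounds the constant of each graph by one
    depending on \<open>C\<close> alone.\<close>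
  have "cut_pseudorandom r (2 * sqrt C) A" if "weighted_graph n A" "core_density A \<le> C" for n A r
    using cut_pseudorandom_mono[OF cut_pseudorandom_core_density[OF that(1)] _ that(1)] that(2)
    by simp
  thus "\<exists>C'::real. C' > 0 \<and> (\<forall>n A. weighted_graph n A \<and> core_density A \<le> C \<longrightarrow>
      (\<forall>r::nat. r \<ge> 1 \<longrightarrow> cut_pseudorandom r C' A))"
    using \<open>C > 0\<close> by (intro exI[of _ "2 * sqrt C"] conjI allI impI) auto
qed

end
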